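(* Let $M$ be a smooth manifold, let $m\ge 2$, let $r>0$, and let $\mathcal{D}=\{(x_i,y_i)\}_{i=1}^N$ be a finite binary classification dataset on $M$, with distinct points $x_i\in M$ and labels $y_i\in\{+1,-1\}$. Let $E=M\times\mathbb{R}^m$ and let $\varphi:\mathbb{R}^m\to\mathbb{R}$ be the readout $\varphi(v)=v_1$, i.e. $\varphi=(1,0,\dots,0)$. Then there exist a smooth section $s:M\to\mathbb{R}^2\hookrightarrow\mathbb{R}^m$ of $E$ of constant norm and a flat $O(2)$-connection $\nabla$ on $E$ such that $(\nabla,s)$ solves the classification problem: $s$ is nowhere zero, $s$ is parallel for $\nabla$ (that is, $\nabla s=0$), and $\varphi(s(x_i))=y_i\,r$ for all $i=1,\dots,N$.
   Context: Sections of the trivial bundle $E=M\times\mathbb{R}^m$ are identified with smooth maps $s:M\to\mathbb{R}^m$. The inclusion $\mathbb{R}^2\hookrightarrow\mathbb{R}^m$ is onto the first two coordinates, and $O(2)\subset O(m)$ acts on the first two coordinates and trivially on the others. An $O(2)$-connection on $E$ is $\nabla=d+\mathcal{A}$ with $\mathcal{A}$ a smooth $1$-form on $M$ with values in $\mathfrak{so}(2)\subset\mathfrak{so}(m)$, i.e. $\mathcal{A}=\theta\cdot J$ with $\theta\in\Omega^1(M)$ a real $1$-form and $J=\begin{pmatrix}0&-1\\1&0\end{pmatrix}$ acting on the first two coordinates. Thus $\nabla s=ds+\mathcal{A}s$. The connection is flat if its curvature $F=d\mathcal{A}+\mathcal{A}\wedge\mathcal{A}$ vanishes identically. The number $r>0$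 is the prescribed section scale in the Dirichlet conditions $\varphi(s(x_i))=y_i r$. *)

theory Defs
  imports "HOL-Analysis.Analysis"
begin

section \<open>Smooth functions between normed spaces\<close>

text \<open>
  \<open>C_on k S f\<close> says that \<open>f\<close> is of class \<open>C^k\<close> on the open set \<open>S\<close>. The recursion goes through all
  directional derivatives, which is the usual notion when the domain is finite-dimensional (the
  only case in which it is used below).
\<close>

fun C_on :: "nat \<Rightarrow> 'e::real_normed_vector set \<Rightarrow> ('e \<Rightarrow> 'b::real_normed_vector) \<Rightarrow> bool" where
  "C_on 0 S f \<longleftrightarrow> continuous_on S f"
| "C_on (Suc k) S f \<longleftrightarrow>
     (\<forall>x\<in>S. f differentiable (at x)) \<and> (\<forall>v. C_on k S (\<lambda>x. frechet_derivative f (at x) v))"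

definition smooth_on :: "'e::real_normed_vector set \<Rightarrow> ('e \<Rightarrow> 'b::real_normed_vector) \<Rightarrow> bool" where
  "smooth_on S f \<longleftrightarrow> (\<forall>k. C_on k S f)"


section \<open>Smooth manifolds\<close>

text \<open>
  The model space is a finite-dimensional real inner product space \<open>'e\<close>. The class
  \<open>euclidean_space\<close> is not used because it forces the dimension to be positive, which would
  exclude 0-dimensional manifolds; the instance for \<open>unit\<close> below is the zero space.
\<close>

instantiation unit :: real_inner
begin

definition "(0::unit) = ()"
definition "(x::unit) + y = ()"
definition "scaleR (r::real) (x::unit) = ()"
definition "norm (x::unit) = (0::real)"
definition "sgn (x::unit) = ()"
definition "dist (x::unit) y = (0::real)"
definition "inner (x::unit) y = (0::real)"
definition "(uniformity :: (unit \<times> unit) filter) = (INF e\<in>{0<..}. principal {(x, y). dist x y < e})"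
definition "open (U :: unit set) \<longleftrightarrow>
  (\<forall>x\<in>U. eventually (\<lambda>(x', y). x' = x \<longrightarrow> y \<in> U) uniformity)"

instance
proof
  show "(uniformity :: (unit \<times> unit) filter) = (INF e\<in>{0<..}. principal {(x, y). dist x y < e})"
    by (rule uniformity_unit_def)
  show "open U \<longleftrightarrow> (\<forall>x\<in>U. eventually (\<lambda>(x', y). x' = x \<longrightarrow> y \<in> U) uniformity)" for U :: "unit set"
    by (rule open_unit_def)
qed (simp_all add: norm_unit_def dist_unit_def inner_unit_def)

end

text \<open>A chart is a pair of its domain and its coordinate map; the values of the coordinate map
  outside the domain are irrelevant.\<close>

type_synonym ('a, 'e) chart = "'a set \<times> ('a \<Rightarrow> 'e)"

definition chart_inv :: "('a, 'e) chart \<Rightarrow> 'e \<Rightarrow> 'a" where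
  "chart_inv c = inv_into (fst c) (snd c)"

definition transition :: "('a, 'e) chart \<Rightarrow> ('a, 'e) chart \<Rightarrow> 'e \<Rightarrow> 'e" where
  "transition c d = snd d \<circ> chart_inv c"

text \<open>The atlas need not be maximal. All notions below are unchanged when it is enlarged by
  compatible charts.\<close>

definition smooth_manifold :: "'a topology \<Rightarrow> ('a, 'e::real_inner) chart set \<Rightarrow> bool" where
  "smooth_manifold M \<A> \<longleftrightarrow>
     (\<exists>B::'e set. finite B \<and> span B = UNIV) \<and>
     Hausdorff_space M \<and> second_countable M \<and>
     (\<Union>c\<in>\<A>. fst c) = topspace M \<and>
     (\<forall>c\<in>\<A>. openin M (fst c) \<and> open (snd c ` fst c) \<and>
        homeomorphic_map (subtopology M (fst c)) (top_of_set (snd c ` fst c)) (snd c)) \<and>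
     (\<forall>c\<in>\<A>. \<forall>d\<in>\<A>. smooth_on (snd c ` (fst c \<inter> fst d)) (transition c d))"

definition smooth_map ::
  "('a, 'e::real_normed_vector) chart set \<Rightarrow> ('a \<Rightarrow> 'b::real_normed_vector) \<Rightarrow> bool" where
  "smooth_map \<A> f \<longleftrightarrow> (\<forall>c\<in>\<A>. smooth_on (snd c ` fst c) (f \<circ> chart_inv c))"


section \<open>Differential forms\<close>

text \<open>
  A form with values in \<open>'b\<close> is given by its local representations: \<open>\<omega> c p v\<close> is the value, at the
  point \<open>p\<close> of the domain of the chart \<open>c\<close>, on the tangent vector at \<open>p\<close> whose coordinate vector
  with respect to \<open>c\<close> is \<open>v\<close>. The last clause of \<open>one_form\<close> expresses that this value depends only
  on the tangent vector and not on the chart.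
\<close>

type_synonym ('a, 'e, 'b) form1 = "('a, 'e) chart \<Rightarrow> 'a \<Rightarrow> 'e \<Rightarrow> 'b"
type_synonym ('a, 'e, 'b) form2 = "('a, 'e) chart \<Rightarrow> 'a \<Rightarrow> 'e \<Rightarrow> 'e \<Rightarrow> 'b"

definition one_form ::
  "('a, 'e::real_normed_vector) chart set \<Rightarrow> ('a, 'e, 'b::real_normed_vector) form1 \<Rightarrow> bool" where
  "one_form \<A> \<omega> \<longleftrightarrow>
     (\<forall>c\<in>\<A>. \<forall>p\<in>fst c. linear (\<omega> c p)) \<and>
     (\<forall>c\<in>\<A>. \<forall>v. smooth_on (snd c ` fst c) (\<lambda>x. \<omega> c (chart_inv c x) v)) \<and>
     (\<forall>c\<in>\<A>. \<forall>d\<in>\<A>. \<forall>p\<in>fst c \<inter> fst d. \<forall>v.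
        \<omega> c p v = \<omega> d p (frechet_derivative (transition c d) (at (snd c p)) v))"

definition differential ::
  "('a \<Rightarrow> 'b::real_normed_vector) \<Rightarrow> ('a, 'e::real_normed_vector, 'b) form1" where
  "differential f c p v = frechet_derivative (f \<circ> chart_inv c) (at (snd c p)) v"

definition ext_deriv ::
  "('a, 'e::real_normed_vector, 'b::real_normed_vector) form1 \<Rightarrow> ('a, 'e, 'b) form2" where
  "ext_deriv \<omega> c p u v =
     frechet_derivative (\<lambda>x. \<omega> c (chart_inv c x) v) (at (snd c p)) u -
     frechet_derivative (\<lambda>x. \<omega> c (chart_inv c x) u) (at (snd c p)) v"

definition wedge ::
  "('a, 'e, real^'m^'m) form1 \<Rightarrow> ('a, 'e, real^'m^'m) form1 \<Rightarrow> ('a, 'e, real^'m^'m) form2" where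
  "wedge \<omega> \<eta> c p u v = \<omega> c p u ** \<eta> c p v - \<omega> c p v ** \<eta> c p u"


section \<open>Connections on the trivial bundle with fibre \<open>real^'m\<close>\<close>

text \<open>
  Throughout, \<open>e\<close> enumerates the index type \<open>'m\<close> as \<open>e 1, \<dots>, e m\<close>, so that the \<open>i\<close>-th coordinate
  of \<open>v\<close> is \<open>v $ e i\<close>. A connection \<open>d + A\<close> is represented by its connection form \<open>A\<close>.
\<close>

text \<open>The Lie algebra of \<open>O(2)\<close>, embedded in the upper left \<open>2 \<times> 2\<close> block.\<close>

definition so2 :: "(nat \<Rightarrow> 'm) \<Rightarrow> (real^'m^'m) set" where
  "so2 e = {B. transpose B = - B \<and>
     (\<forall>i j. i \<notin> {e 1, e 2} \<or> j \<notin> {e 1, e 2} \<longrightarrow> B $ i $ j = 0)}"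

definition rotJ :: "(nat \<Rightarrow> 'm) \<Rightarrow> real^'m^'m" where
  "rotJ e = (\<chi> i j. if i = e 1 \<and> j = e 2 then -1 else if i = e 2 \<and> j = e 1 then 1 else 0)"

lemma so2_eq:
  assumes "e 1 \<noteq> e 2"
  shows "so2 e = range (\<lambda>t. t *\<^sub>R rotJ e)"
proof (intro equalityI subsetI)
  fix B assume B: "B \<in> so2 e"
  have skew: "B $ j $ i = - B $ i $ j" for i j
  proof -
    have "transpose B $ i $ j = (- B) $ i $ j"
      using B by (simp add: so2_def)
    then show ?thesis by (simp only: transpose_def vec_lambda_beta vector_uminus_component)
  qed
  have diag: "B $ i $ i = 0" for i
    using skew[of i i] by simp
  have "B = (B $ e 2 $ e 1) *\<^sub>R rotJ e"
    unfolding vec_eq_iff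
  proof (intro allI)
    fix i j
    show "B $ i $ j = ((B $ e 2 $ e 1) *\<^sub>R rotJ e) $ i $ j"
    proof (cases "i \<in> {e 1, e 2} \<and> j \<in> {e 1, e 2}")
      case True
      then show ?thesis
        using assms diag[of "e 1"] diag[of "e 2"] skew[of "e 1" "e 2"] by (elim conjE insertE) (simp_all add: rotJ_def)
    next
      case False
      then have "B $ i $ j = 0" using B unfolding so2_def by blast
      moreover have "\<not> (i = e 1 \<and> j = e 2)" "\<not> (i = e 2 \<and> j = e 1)"
        using False by blast+
      ultimately show ?thesis by (simp only: rotJ_def vector_scaleR_component vec_lambda_beta if_False) simp
    qed
  qed
  then show "B \<in> range (\<lambda>t. t *\<^sub>R rotJ e)" by blast
next
  fix B assume "B \<in> range (\<lambda>t. t *\<^sub>R rotJ e)"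
  then obtain t where B: "B = t *\<^sub>R rotJ e" by blast
  have "transpose B $ i $ j = (- B) $ i $ j" for i j
    using assms by (simp add: B rotJ_def transpose_def)
  then have "transpose B = - B" by (simp only: vec_eq_iff) simp
  moreover have "B $ i $ j = 0" if "i \<notin> {e 1, e 2} \<or> j \<notin> {e 1, e 2}" for i j
  proof -
    have "\<not> (i = e 1 \<and> j = e 2)" "\<not> (i = e 2 \<and> j = e 1)"
      using that by blast+
    then show ?thesis by (simp only: B rotJ_def vector_scaleR_component vec_lambda_beta if_False) simp
  qed
  ultimately show "B \<in> so2 e" unfolding so2_def by blast
qed

definition O2_connection ::
  "(nat \<Rightarrow> 'm) \<Rightarrow> ('a, 'e::real_normed_vector) chart set \<Rightarrow>
    ('a, 'e, real^'m::finite^'m) form1 \<Rightarrow> bool" where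
  "O2_connection e \<A> A \<longleftrightarrow>
     one_form \<A> A \<and> (\<forall>c\<in>\<A>. \<forall>p\<in>fst c. \<forall>v. A c p v \<in> so2 e)"

definition curvature ::
  "('a, 'e::real_normed_vector, real^'m::finite^'m) form1 \<Rightarrow> ('a, 'e, real^'m^'m) form2" where
  "curvature A c p u v = ext_deriv A c p u v + wedge A A c p u v"

definition flat ::
  "('a, 'e::real_normed_vector) chart set \<Rightarrow> ('a, 'e, real^'m::finite^'m) form1 \<Rightarrow> bool" where
  "flat \<A> A \<longleftrightarrow> (\<forall>c\<in>\<A>. \<forall>p\<in>fst c. \<forall>u v. curvature A c p u v = 0)"

definition cov_deriv ::
  "('a, 'e::real_normed_vector, real^'m::finite^'m) form1 \<Rightarrow> ('a \<Rightarrow> real^'m) \<Rightarrow>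
    ('a, 'e, real^'m) form1" where
  "cov_deriv A s c p v = differential s c p v + A c p v *v s p"

definition parallel ::
  "('a, 'e::real_normed_vector) chart set \<Rightarrow> ('a, 'e, real^'m::finite^'m) form1 \<Rightarrow>
    ('a \<Rightarrow> real^'m) \<Rightarrow> bool" where
  "parallel \<A> A s \<longleftrightarrow> (\<forall>c\<in>\<A>. \<forall>p\<in>fst c. \<forall>v. cov_deriv A s c p v = 0)"


section \<open>Classification problems\<close>

definition classification_dataset ::
  "'a topology \<Rightarrow> nat \<Rightarrow> (nat \<Rightarrow> 'a) \<Rightarrow> (nat \<Rightarrow> real) \<Rightarrow> bool" where
  "classification_dataset M N x y \<longleftrightarrow>
     inj_on x {1..N} \<and> (\<forall>i\<in>{1..N}. x i \<in> topspace M \<and> y i \<in> {1, -1})"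

definition readout :: "(nat \<Rightarrow> 'm) \<Rightarrow> real^'m \<Rightarrow> real" where
  "readout e v = v $ e 1"

definition solves_classification ::
  "'a topology \<Rightarrow> ('a, 'e::real_normed_vector) chart set \<Rightarrow> nat \<Rightarrow> (nat \<Rightarrow> 'a) \<Rightarrow> (nat \<Rightarrow> real) \<Rightarrow>
    (real^'m \<Rightarrow> real) \<Rightarrow> real \<Rightarrow> ('a, 'e, real^'m::finite^'m) form1 \<Rightarrow> ('a \<Rightarrow> real^'m) \<Rightarrow> bool" where
  "solves_classification M \<A> N x y \<phi> r A s \<longleftrightarrow>
     (\<forall>p\<in>topspace M. s p \<noteq> 0) \<and> parallel \<A> A s \<and> (\<forall>i\<in>{1..N}. \<phi> (s (x i)) = y i * r)"

end

theory Submission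
  imports Defs "HOL-Computational_Algebra.Polynomial"
begin

text \<open>
  The section rotates in the plane of the first two coordinates by an angle that depends smoothly
  on the point. Let \<open>f\<close> be a smooth real function on the manifold with \<open>f(x\<^sub>i) = 0\<close> where \<open>y\<^sub>i = 1\<close> and
  \<open>f(x\<^sub>i) = \<pi>\<close> where \<open>y\<^sub>i = -1\<close>, and put \<open>s = r (cos f, sin f, 0, \<dots>, 0)\<close>. The norm of \<open>s\<close> is \<open>r\<close>, and
  the first coordinate at \<open>x\<^sub>i\<close> is \<open>r cos f(x\<^sub>i) = y\<^sub>i r\<close>. Since the circle is an orbit of the rotations
  \<open>exp(tJ)\<close>, the differential is \<open>ds = df J s\<close>; hence \<open>s\<close> is parallel for the connection form
  \<open>A = -df J\<close>. This connection is flat: \<open>dA = 0\<close> because \<open>df\<close> is closed, and \<open>A \<and> A = 0\<close> because the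
  values of \<open>A\<close> are multiples of one matrix.

  Two ingredients need work. The function \<open>f\<close> is obtained from bump functions
  (\<open>smooth_bump_on_manifold\<close>, \<open>smooth_interpolation\<close>). These rest on the smoothness of \<open>exp (-1/t)\<close>
  extended by zero, on the closure of \<open>C^k\<close> functions under composition (\<open>C_on_compose\<close>), and on
  compactness of closed balls in the model space (\<open>compact_cball_of_finite_span\<close>), which makes the
  support of a bump closed in the manifold. Closedness of \<open>df\<close> is symmetry of second derivatives
  (\<open>frechet_derivative_commute\<close>, \<open>ext_deriv_differential\<close>). The model space has only an inner product
  and a finite spanning set, so both composition and compactness go through expansions in an
  orthogonal family (\<open>dual_basis_exists\<close>).
\<close>

section \<open>Calculus of \<open>C^k\<close> functions\<close>

lemma C_on_cong:
  assumes "open S" "\<And>x. x \<in> S \<Longrightarrow> f x = g x" "C_on k S f"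
  shows "C_on k S g"
  using assms(2,3)
proof (induction k arbitrary: f g)
  case 0
  then show ?case using continuous_on_cong by fastforce
next
  case (Suc k)
  have diff: "f differentiable (at x)" if "x \<in> S" for x
    using Suc.prems that by simp
  have "g differentiable (at x)" if "x \<in> S" for x
    using diff[OF that] unfolding differentiable_def
    by (blast intro: has_derivative_transform_within_open[of f _ x UNIV S g] \<open>open S\<close> that Suc.prems(1))
  moreover have "C_on k S (\<lambda>x. frechet_derivative g (at x) v)" for v
  proof (rule Suc.IH)
    show "C_on k S (\<lambda>x. frechet_derivative f (at x) v)" using Suc.prems by simp
    show "frechet_derivative f (at x) v = frechet_derivative g (at x) v" if "x \<in> S" for x
      using frechet_derivative_transform_within_open[OF diff[OF that] \<open>open S\<close> that Suc.prems(1)]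
      by simp
  qed
  ultimately show ?case by simp
qed

lemma C_on_Union:
  "(\<And>U. U \<in> \<U> \<Longrightarrow> open U) \<Longrightarrow> (\<And>U. U \<in> \<U> \<Longrightarrow> C_on k U f) \<Longrightarrow> C_on k (\<Union>\<U>) f"
  by (induction k arbitrary: f) (auto intro: continuous_on_open_Union)

text \<open>The Frechet derivative chosen by \<open>frechet_derivative\<close> is rarely available in closed form. This rule
  lets any explicit derivative on an open set take its place, and the closure properties below
  rest on it, by induction on the order of smoothness.\<close>

lemma C_on_SucI:
  assumes "open S"
    and der: "\<And>x. x \<in> S \<Longrightarrow> (f has_derivative f' x) (at x)"
    and "\<And>v. C_on k S (\<lambda>x. f' x v)"
  shows "C_on (Suc k) S f"
proof -
  have "C_on k S (\<lambda>x. frechet_derivative f (at x) v)" for v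
    by (rule C_on_cong[OF assms(1) _ assms(3)]) (simp add: frechet_derivative_at[OF der, symmetric])
  then show ?thesis using der unfolding C_on.simps differentiable_def by blast
qed

lemma C_on_SucD:
  assumes "C_on (Suc k) S f"
  shows "x \<in> S \<Longrightarrow> (f has_derivative frechet_derivative f (at x)) (at x)"
    and "C_on k S (\<lambda>x. frechet_derivative f (at x) v)"
  using assms by (auto simp: frechet_derivative_works)

lemma C_on_pred: "C_on (Suc k) S f \<Longrightarrow> C_on k S f"
proof (induction k arbitrary: f)
  case 0
  then show ?case
    by (auto intro!: continuous_at_imp_continuous_on differentiable_imp_continuous_within)
next
  case (Suc k)
  have "C_on k S (\<lambda>x. frechet_derivative f (at x) v)" for v
    by (rule Suc.IH) (rule C_on_SucD(2)[OF Suc.prems])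
  then show ?case using Suc.prems by simp
qed

lemma C_on_const: "open S \<Longrightarrow> C_on k S (\<lambda>x. c)"
proof (induction k arbitrary: c)
  case (Suc k)
  show ?case by (rule C_on_SucI[OF Suc.prems has_derivative_const Suc.IH[OF Suc.prems]])
qed simp

lemma C_on_add:
  assumes "open S"
  shows "C_on k S f \<Longrightarrow> C_on k S g \<Longrightarrow> C_on k S (\<lambda>x. f x + g x)"
proof (induction k arbitrary: f g)
  case (Suc k)
  show ?case
    by (rule C_on_SucI[OF assms has_derivative_add[OF C_on_SucD(1)[OF Suc.prems(1)] C_on_SucD(1)[OF Suc.prems(2)]]])
      (auto intro!: Suc.IH C_on_SucD(2)[OF Suc.prems(1)] C_on_SucD(2)[OF Suc.prems(2)])
qed (auto intro: continuous_intros)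

lemma C_on_sum:
  assumes "open S" "finite I" "\<And>i. i \<in> I \<Longrightarrow> C_on k S (f i)"
  shows "C_on k S (\<lambda>x. \<Sum>i\<in>I. f i x)"
  using assms(2,3)
  by (induction I) (auto intro: C_on_const C_on_add assms(1))

lemma C_on_bounded_linear:
  assumes "open S" "bounded_linear L"
  shows "C_on k S f \<Longrightarrow> C_on k S (\<lambda>x. L (f x))"
proof (induction k arbitrary: f)
  case 0
  then show ?case using bounded_linear.continuous_on[OF assms(2)] by simp
next
  case (Suc k)
  show ?case
    by (rule C_on_SucI[OF assms(1) bounded_linear.has_derivative[OF assms(2) C_on_SucD(1)[OF Suc.prems]]])
      (auto intro: Suc.IH C_on_SucD(2)[OF Suc.prems])
qed

lemma C_on_scaleR:
  assumes "open S"
  shows "C_on k S f \<Longrightarrow> C_on k S g \<Longrightarrow> C_on k S (\<lambda>x. f x *\<^sub>R g x)"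
proof (induction k arbitrary: f g)
  case (Suc k)
  show ?case
    by (rule C_on_SucI[OF assms has_derivative_scaleR[OF C_on_SucD(1)[OF Suc.prems(1)] C_on_SucD(1)[OF Suc.prems(2)]]])
      (auto intro!: C_on_add[OF assms] Suc.IH C_on_SucD(2)[OF Suc.prems(1)] C_on_SucD(2)[OF Suc.prems(2)]
         C_on_pred[OF Suc.prems(1)] C_on_pred[OF Suc.prems(2)])
qed (auto intro: continuous_intros)

text \<open>The model space only has the class \<open>real_inner\<close> together with a finite spanning set, so there is no
  \<open>Basis\<close> to expand vectors in. Orthogonalising the spanning set replaces it: the coefficient of
  \<open>z\<close> at \<open>b\<close> is \<open>z \<bullet> b / (b \<bullet> b)\<close>, and zero vectors among the orthogonal family are harmless because
  their term vanishes.\<close>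

lemma dual_basis_exists:
  fixes B :: "'e::real_inner set"
  assumes "finite B" "span B = UNIV"
  obtains C and \<beta> :: "'e \<Rightarrow> 'e" where "finite C" "\<And>z. z = (\<Sum>b\<in>C. (\<beta> b \<bullet> z) *\<^sub>R b)"
proof -
  obtain C where C: "finite C" "span C = (UNIV::'e set)" "pairwise orthogonal C"
    using basis_orthogonal[OF assms(1)] assms(2) by metis
  define \<beta> where "\<beta> b = b /\<^sub>R (b \<bullet> b)" for b :: 'e
  have "z = (\<Sum>b\<in>C. (\<beta> b \<bullet> z) *\<^sub>R b)" for z
  proof -
    have "z \<in> span C" using C by simp
    then obtain u where u: "z = (\<Sum>a\<in>C. u a *\<^sub>R a)"
      using C(1) by (auto simp: span_finite)
    have "(\<beta> b \<bullet> z) *\<^sub>R b = u b *\<^sub>R b" if "b \<in> C" for b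
    proof -
      have "b \<bullet> z = (\<Sum>a\<in>C. if a = b then u b * (b \<bullet> b) else 0)"
        unfolding u inner_sum_right
        by (rule sum.cong) (use C(3) that in \<open>auto simp: pairwise_def orthogonal_def\<close>)
      then have "b \<bullet> z = u b * (b \<bullet> b)" using C(1) that by simp
      then show ?thesis by (cases "b = 0") (auto simp: \<beta>_def)
    qed
    then have "(\<Sum>b\<in>C. (\<beta> b \<bullet> z) *\<^sub>R b) = (\<Sum>b\<in>C. u b *\<^sub>R b)" by (rule sum.cong[OF refl])
    with u show ?thesis by (rule trans[OF _ sym])
  qed
  with C(1) that show thesis by blast
qed

text \<open>The chain rule gives \<open>D(g \<circ> f)(x) v = Dg(f x) (Df(x) v)\<close>, in which the direction fed to \<open>Dg\<close> moves
  with \<open>x\<close>, whereas \<open>C_on\<close> controls \<open>Dg\<close> in constant directions only. Expanding \<open>Df(x) v\<close> in a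
  finite spanning family turns the expression into a finite sum of products of \<open>C^k\<close> functions.
  This is where finite dimension of the middle space enters.\<close>

lemma C_on_compose:
  fixes f :: "'d::real_normed_vector \<Rightarrow> 'e::real_inner" and g :: "'e \<Rightarrow> 'b::real_normed_vector"
  assumes "finite B" "span B = (UNIV::'e set)" "open S" "f ` S \<subseteq> T"
  shows "C_on k T g \<Longrightarrow> C_on k S f \<Longrightarrow> C_on k S (g \<circ> f)"
proof (induction k arbitrary: g)
  case 0
  then show ?case
    using assms(4) continuous_on_compose[of S f g] continuous_on_subset[of T g "f ` S"] by simp
next
  case (Suc k)
  obtain C and \<beta> :: "'e \<Rightarrow> 'e" where C: "finite C" "\<And>z. z = (\<Sum>b\<in>C. (\<beta> b \<bullet> z) *\<^sub>R b)"
    using dual_basis_exists[OF assms(1,2)] by blast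
  let ?Df = "\<lambda>x. frechet_derivative f (at x)" and ?Dg = "\<lambda>z. frechet_derivative g (at z)"
  have der_g: "(g has_derivative ?Dg (f x)) (at (f x))" if "x \<in> S" for x
    using C_on_SucD(1)[OF Suc.prems(1)] assms(4) that by blast
  have der: "(g \<circ> f has_derivative (\<lambda>v. \<Sum>b\<in>C. (\<beta> b \<bullet> ?Df x v) *\<^sub>R (?Dg (f x) b))) (at x)"
    if "x \<in> S" for x
  proof -
    have lin: "linear (?Dg (f x))"
      using der_g[OF that] has_derivative_linear by blast
    have "(\<Sum>b\<in>C. (\<beta> b \<bullet> w) *\<^sub>R (?Dg (f x) b)) = ?Dg (f x) w" for w
      by (subst (2) C(2)[of w]) (simp add: linear_sum[OF lin] linear_scale[OF lin])
    then show ?thesis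
      using diff_chain_at[OF C_on_SucD(1)[OF Suc.prems(2) that] der_g[OF that]]
      by (simp add: o_def)
  qed
  show ?case
  proof (rule C_on_SucI[OF assms(3) der])
    show "C_on k S (\<lambda>x. \<Sum>b\<in>C. (\<beta> b \<bullet> ?Df x v) *\<^sub>R (?Dg (f x) b))" for v
    proof (intro C_on_sum[OF assms(3) C(1)] C_on_scaleR[OF assms(3)])
      fix b
      show "C_on k S (\<lambda>x. \<beta> b \<bullet> ?Df x v)"
        by (rule C_on_bounded_linear[OF assms(3) bounded_linear_inner_right C_on_SucD(2)[OF Suc.prems(2)]])
      show "C_on k S (\<lambda>x. ?Dg (f x) b)"
        using Suc.IH[OF C_on_SucD(2)[OF Suc.prems(1)] C_on_pred[OF Suc.prems(2)]]
        by (simp add: o_def)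
    qed
  qed
qed

text \<open>Heine-Borel without \<open>euclidean_space\<close>. A ball around the origin lies in the set of combinations
  with coefficients bounded by Cauchy-Schwarz; that set is the continuous image of a box, built up
  one direction at a time.\<close>

lemma compact_cball_of_finite_span:
  fixes B :: "'e::real_inner set"
  assumes "finite B" "span B = UNIV"
  shows "compact (cball (a::'e) \<rho>)"
proof -
  obtain C and \<beta> :: "'e \<Rightarrow> 'e" where C: "finite C" "\<And>z. z = (\<Sum>b\<in>C. (\<beta> b \<bullet> z) *\<^sub>R b)"
    using dual_basis_exists[OF assms] by blast
  define P where "P D = {z. \<exists>u. (\<forall>b\<in>D. \<bar>u b\<bar> \<le> norm (\<beta> b) * \<rho>) \<and> z = (\<Sum>b\<in>D. u b *\<^sub>R b)}" for D
  have "compact (P D)" if "finite D" for D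
    using that
  proof induction
    case empty
    have "P {} = {0}" by (auto simp: P_def)
    then show ?case by simp
  next
    case (insert b D)
    let ?I = "{- (norm (\<beta> b) * \<rho>) .. norm (\<beta> b) * \<rho>}"
    have "P (insert b D) = (\<lambda>(t, z). t *\<^sub>R b + z) ` (?I \<times> P D)" (is "_ = ?R")
    proof (intro equalityI subsetI)
      fix z assume "z \<in> P (insert b D)"
      then obtain u where u: "\<forall>c\<in>insert b D. \<bar>u c\<bar> \<le> norm (\<beta> c) * \<rho>" "z = (\<Sum>c\<in>insert b D. u c *\<^sub>R c)"
        by (auto simp: P_def)
      then have "z = (case (u b, \<Sum>c\<in>D. u c *\<^sub>R c) of (t, z) \<Rightarrow> t *\<^sub>R b + z)" using insert by simp
      moreover have "(u b, \<Sum>c\<in>D. u c *\<^sub>R c) \<in> ?I \<times> P D"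
        using u(1) unfolding P_def by (auto simp: abs_le_iff)
      ultimately show "z \<in> ?R" by (rule image_eqI)
    next
      fix z assume "z \<in> ?R"
      then obtain t u where t: "t \<in> ?I" "\<forall>c\<in>D. \<bar>u c\<bar> \<le> norm (\<beta> c) * \<rho>" "z = t *\<^sub>R b + (\<Sum>c\<in>D. u c *\<^sub>R c)"
        by (auto simp: P_def)
      have "(\<Sum>c\<in>D. (u(b := t)) c *\<^sub>R c) = (\<Sum>c\<in>D. u c *\<^sub>R c)"
        by (rule sum.cong) (use insert in auto)
      then have "z = (\<Sum>c\<in>insert b D. (u(b := t)) c *\<^sub>R c)" using t insert by simp
      moreover have "\<forall>c\<in>insert b D. \<bar>(u(b := t)) c\<bar> \<le> norm (\<beta> c) * \<rho>" using t by auto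
      ultimately show "z \<in> P (insert b D)" unfolding P_def by blast
    qed
    moreover have "compact ?R"
      by (intro compact_continuous_image compact_Times insert.IH compact_Icc)
        (auto simp: case_prod_unfold intro!: continuous_intros)
    ultimately show ?case by simp
  qed
  from this[OF C(1)] have "compact (P C)" .
  moreover have "cball 0 \<rho> \<subseteq> P C"
  proof
    fix z :: 'e assume "z \<in> cball 0 \<rho>"
    then have "norm z \<le> \<rho>" by simp
    then have "\<forall>b\<in>C. \<bar>\<beta> b \<bullet> z\<bar> \<le> norm (\<beta> b) * \<rho>"
      by (meson Cauchy_Schwarz_ineq2 mult_left_mono norm_ge_zero order_trans)
    then show "z \<in> P C" unfolding P_def
      by (intro CollectI exI[of _ "\<lambda>b. \<beta> b \<bullet> z"] conjI C(2))
  qed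
  ultimately have "compact (cball (0::'e) \<rho>)"
    by (metis closed_cball compact_Int_closed inf.absorb_iff2)
  then have "compact ((+) a ` cball 0 \<rho>)" by (rule compact_translation)
  then show ?thesis by simp
qed

text \<open>Symmetry of second derivatives. The second difference
  \<open>f(x + hu + hv) - f(x + hu) - f(x + hv) + f x\<close> is symmetric in \<open>u\<close> and \<open>v\<close>. Two applications of the
  mean value theorem express it as \<open>h^2\<close> times the mixed derivative in one order or in the other,
  each at some point within distance \<open>O(h)\<close> of \<open>x\<close>. By continuity the two values at \<open>x\<close> agree.\<close>

lemma frechet_derivative_commute:
  fixes f :: "'e::real_normed_vector \<Rightarrow> real"
  assumes "open S" "C_on 2 S f" "x \<in> S"
  shows "frechet_derivative (\<lambda>z. frechet_derivative f (at z) v) (at x) u =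
         frechet_derivative (\<lambda>z. frechet_derivative f (at z) u) (at x) v"
proof -
  let ?D = "\<lambda>w z. frechet_derivative f (at z) w"
  let ?DD = "\<lambda>u v z. frechet_derivative (?D v) (at z) u"
  have C2: "C_on (Suc (Suc 0)) S f" using assms(2) by (simp add: numeral_2_eq_2)
  have D1: "(f has_derivative frechet_derivative f (at z)) (at z)" if "z \<in> S" for z
    by (rule C_on_SucD(1)[OF C2 that])
  have D2: "(?D w has_derivative frechet_derivative (?D w) (at z)) (at z)" if "z \<in> S" for z w
    by (rule C_on_SucD(1)[OF C_on_SucD(2)[OF C2] that])
  have cont: "continuous_on S (?DD u v)" for u v
    using C_on_SucD(2)[OF C_on_SucD(2)[OF C2]] by simp
  obtain \<epsilon> where \<epsilon>: "\<epsilon> > 0" "ball x \<epsilon> \<subseteq> S" using assms(1,3) openE by blast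
  \<comment> \<open>All points of the parallelogram spanned by \<open>h u\<close> and \<open>h v\<close> at \<open>x\<close> lie within \<open>h K\<close> of \<open>x\<close>;
    the summand 1 makes the bound strict and keeps \<open>K\<close> positive when \<open>u = v = 0\<close>.\<close>
  define K where "K = norm u + norm v + 1"
  have K: "K > 0" by (simp add: K_def add_nonneg_pos)
  have near: "x + s *\<^sub>R u + t *\<^sub>R v \<in> ball x (h * K)"
    if "0 \<le> s" "s \<le> h" "0 \<le> t" "t \<le> h" "h > 0" for s t h
  proof -
    have "norm (s *\<^sub>R u + t *\<^sub>R v) \<le> s * norm u + t * norm v"
      using norm_triangle_ineq[of "s *\<^sub>R u" "t *\<^sub>R v"] that by simp
    also have "\<dots> \<le> h * norm u + h * norm v"
      using that by (intro add_mono mult_right_mono) auto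
    also have "\<dots> < h * K" using that by (simp add: K_def algebra_simps)
    finally have "norm (s *\<^sub>R u + t *\<^sub>R v) < h * K" .
    moreover have "dist x (x + w) = norm w" for w by (simp add: dist_norm)
    ultimately show ?thesis by (simp add: add.assoc del: dist_add_cancel)
  qed
  have line: "((\<lambda>s. g (p + s *\<^sub>R w)) has_real_derivative frechet_derivative g (at (p + s *\<^sub>R w)) w) (at s)"
    if "(g has_derivative frechet_derivative g (at (p + s *\<^sub>R w))) (at (p + s *\<^sub>R w))"
    for g :: "'e \<Rightarrow> real" and p w s
  proof -
    have "((\<lambda>s. p + s *\<^sub>R w) has_derivative (\<lambda>h. h *\<^sub>R w)) (at s)"
      by (auto intro!: derivative_eq_intros)
    from diff_chain_at[OF this that]
    have "((\<lambda>s. g (p + s *\<^sub>R w)) has_derivative (\<lambda>h. frechet_derivative g (at (p + s *\<^sub>R w)) (h *\<^sub>R w))) (at s)"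
      by (simp add: o_def)
    moreover have "(\<lambda>h. frechet_derivative g (at (p + s *\<^sub>R w)) (h *\<^sub>R w)) = (*) (frechet_derivative g (at (p + s *\<^sub>R w)) w)"
      using linear_scale[OF has_derivative_linear[OF that]] by (auto simp: mult.commute)
    ultimately show ?thesis by (simp add: has_field_derivative_def)
  qed
  define \<Delta> where "\<Delta> h = f (x + h *\<^sub>R u + h *\<^sub>R v) - f (x + h *\<^sub>R u) - f (x + h *\<^sub>R v) + f x" for h
  have mean: "\<exists>s t. 0 \<le> s \<and> s \<le> h \<and> 0 \<le> t \<and> t \<le> h \<and>
       f (x + h *\<^sub>R a + h *\<^sub>R b) - f (x + h *\<^sub>R a) - f (x + h *\<^sub>R b) + f x = h * h * ?DD b a (x + s *\<^sub>R a + t *\<^sub>R b)"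
    if h: "h > 0" and inS: "\<And>s t. 0 \<le> s \<Longrightarrow> s \<le> h \<Longrightarrow> 0 \<le> t \<Longrightarrow> t \<le> h \<Longrightarrow> x + s *\<^sub>R a + t *\<^sub>R b \<in> S"
    for h a b
  proof -
    \<comment> \<open>The second difference is the increment over \<open>[0, h]\<close> of the first difference \<open>?\<phi>\<close>.\<close>
    let ?\<phi> = "\<lambda>s. f (x + h *\<^sub>R b + s *\<^sub>R a) - f (x + s *\<^sub>R a)"
    have in1: "x + h *\<^sub>R b + s *\<^sub>R a \<in> S" "x + s *\<^sub>R a \<in> S" if "0 \<le> s" "s \<le> h" for s
      using inS[of s h] inS[of s 0] that h by (simp_all add: algebra_simps)
    obtain s where s: "0 < s" "s < h"
      "?\<phi> h - ?\<phi> 0 = (h - 0) * (?D a (x + h *\<^sub>R b + s *\<^sub>R a) - ?D a (x + s *\<^sub>R a))"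
      using MVT2[OF h, of ?\<phi> "\<lambda>s. ?D a (x + h *\<^sub>R b + s *\<^sub>R a) - ?D a (x + s *\<^sub>R a)"]
        DERIV_diff[OF line[OF D1[OF in1(1)]] line[OF D1[OF in1(2)]]] by auto
    have in2: "(x + s *\<^sub>R a) + t *\<^sub>R b \<in> S" if "0 \<le> t" "t \<le> h" for t
      using inS[of s t] that s by simp
    obtain t where t: "0 < t" "t < h"
      "?D a ((x + s *\<^sub>R a) + h *\<^sub>R b) - ?D a ((x + s *\<^sub>R a) + 0 *\<^sub>R b) = (h - 0) * ?DD b a ((x + s *\<^sub>R a) + t *\<^sub>R b)"
      using MVT2[OF h, of "\<lambda>t. ?D a ((x + s *\<^sub>R a) + t *\<^sub>R b)" "\<lambda>t. ?DD b a ((x + s *\<^sub>R a) + t *\<^sub>R b)"]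
        line[OF D2[OF in2]] by blast
    have "?D a (x + h *\<^sub>R b + s *\<^sub>R a) - ?D a (x + s *\<^sub>R a) = h * ?DD b a (x + s *\<^sub>R a + t *\<^sub>R b)"
      using t(3) by (simp add: add_ac)
    then have "?\<phi> h - ?\<phi> 0 = h * h * ?DD b a (x + s *\<^sub>R a + t *\<^sub>R b)"
      using s(3) by simp
    then have "f (x + h *\<^sub>R a + h *\<^sub>R b) - f (x + h *\<^sub>R a) - f (x + h *\<^sub>R b) + f x = h * h * ?DD b a (x + s *\<^sub>R a + t *\<^sub>R b)"
      by (simp add: add_ac)
    then show ?thesis using s(1,2) t(1,2) less_imp_le by meson
  qed
  show ?thesis
  proof (rule ccontr)
    assume ne: "?DD u v x \<noteq> ?DD v u x"
    define \<eta> where "\<eta> = \<bar>?DD u v x - ?DD v u x\<bar> / 2"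
    have \<eta>: "\<eta> > 0" using ne by (simp add: \<eta>_def)
    have "\<exists>\<delta>>0. \<forall>z\<in>ball x \<delta>. \<bar>?DD a b z - ?DD a b x\<bar> < \<eta>" for a b
    proof -
      obtain \<delta> where "\<delta> > 0" "\<forall>z\<in>S. dist z x < \<delta> \<longrightarrow> dist (?DD a b z) (?DD a b x) < \<eta>"
        using cont[unfolded continuous_on_iff] \<eta> assms(3) by meson
      then show ?thesis using \<epsilon>
        by (intro exI[of _ "min \<delta> \<epsilon>"]) (auto simp: dist_real_def dist_commute subset_iff)
    qed
    then obtain \<delta>1 \<delta>2 where \<delta>: "\<delta>1 > 0" "\<delta>2 > 0"
      "\<And>z. z \<in> ball x \<delta>1 \<Longrightarrow> \<bar>?DD u v z - ?DD u v x\<bar> < \<eta>"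
      "\<And>z. z \<in> ball x \<delta>2 \<Longrightarrow> \<bar>?DD v u z - ?DD v u x\<bar> < \<eta>" by metis
    define h where "h = min \<epsilon> (min \<delta>1 \<delta>2) / K"
    have h: "h > 0" "h * K \<le> \<epsilon>" "h * K \<le> \<delta>1" "h * K \<le> \<delta>2"
      using \<epsilon>(1) \<delta>(1,2) K by (auto simp: h_def)
    have nb: "x + s *\<^sub>R u + t *\<^sub>R v \<in> ball x (h * K)" "x + t *\<^sub>R v + s *\<^sub>R u \<in> ball x (h * K)"
      if "0 \<le> s" "s \<le> h" "0 \<le> t" "t \<le> h" for s t
      using near[OF that h(1)] by (simp_all add: add_ac)
    have inS: "z \<in> S" if "z \<in> ball x (h * K)" for z
      using that h(2) \<epsilon>(2) by auto
    obtain s t where st: "0 \<le> s" "s \<le> h" "0 \<le> t" "t \<le> h" "\<Delta> h = h * h * ?DD v u (x + s *\<^sub>R u + t *\<^sub>R v)"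
      using mean[OF h(1), of u v] nb(1) inS unfolding \<Delta>_def by blast
    have "\<exists>s t. 0 \<le> s \<and> s \<le> h \<and> 0 \<le> t \<and> t \<le> h \<and>
       f (x + h *\<^sub>R v + h *\<^sub>R u) - f (x + h *\<^sub>R v) - f (x + h *\<^sub>R u) + f x = h * h * ?DD u v (x + s *\<^sub>R v + t *\<^sub>R u)"
      by (rule mean[OF h(1)]) (use nb(2) inS in blast)
    then obtain s' t' where st': "0 \<le> s'" "s' \<le> h" "0 \<le> t'" "t' \<le> h"
      "\<Delta> h = h * h * ?DD u v (x + s' *\<^sub>R v + t' *\<^sub>R u)"
      unfolding \<Delta>_def by (auto simp: add_ac)
    have "?DD v u (x + s *\<^sub>R u + t *\<^sub>R v) = ?DD u v (x + s' *\<^sub>R v + t' *\<^sub>R u)"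
      using st(5) st'(5) h(1) by simp
    moreover have "\<bar>?DD v u (x + s *\<^sub>R u + t *\<^sub>R v) - ?DD v u x\<bar> < \<eta>"
      using nb(1)[OF st(1-4)] h(4) by (intro \<delta>(4)) auto
    moreover have "\<bar>?DD u v (x + s' *\<^sub>R v + t' *\<^sub>R u) - ?DD u v x\<bar> < \<eta>"
      using nb(2)[OF st'(3,4,1,2)] h(3) by (intro \<delta>(3)) auto
    ultimately show False unfolding \<eta>_def by argo
  qed
qed

section \<open>Smooth bump functions on the model space\<close>

text \<open>The polynomial factor is there to close the family under differentiation: all derivatives of
  \<open>exp (-1/t)\<close>, extended by zero to \<open>t \<le> 0\<close>, are again of this form.\<close>

definition exp_cutoff :: "real poly \<Rightarrow> real \<Rightarrow> real" where
  "exp_cutoff p t = (if t > 0 then poly p (1 / t) * exp (- (1 / t)) else 0)"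

lemma poly_times_exp_tendsto_0: "((\<lambda>u. poly p u * exp (- u)) \<longlongrightarrow> (0::real)) at_top"
proof -
  have "((\<lambda>u. \<Sum>i\<le>degree p. coeff p i * (u ^ i / exp u)) \<longlongrightarrow> (\<Sum>i\<le>degree p. coeff p i * 0)) at_top"
    by (intro tendsto_intros tendsto_power_div_exp_0)
  then show ?thesis
    by (simp add: poly_altdef exp_minus field_simps sum_distrib_left sum_divide_distrib)
qed

lemma exp_cutoff_tendsto_0: "(exp_cutoff p \<longlongrightarrow> 0) (at 0)"
proof -
  have "((\<lambda>t. poly p (inverse t) * exp (- inverse t)) \<longlongrightarrow> 0) (at_right 0)"
    by (rule filterlim_compose[OF poly_times_exp_tendsto_0 filterlim_inverse_at_top_right])
  then have "(exp_cutoff p \<longlongrightarrow> 0) (at_right 0)"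
    by (rule Lim_transform_eventually)
      (auto simp: eventually_at_right_field exp_cutoff_def inverse_eq_divide intro!: exI[of _ 1])
  moreover have "(exp_cutoff p \<longlongrightarrow> 0) (at_left 0)"
    by (rule Lim_transform_eventually[OF tendsto_const])
      (auto simp: eventually_at_left_field exp_cutoff_def intro!: exI[of _ "-1"])
  ultimately show ?thesis by (simp add: filterlim_split_at)
qed

text \<open>For \<open>t > 0\<close>, with \<open>w = 1/t\<close>, the derivative of \<open>p(w) exp(-w)\<close> is \<open>-w^2 (p'(w) - p(w)) exp(-w)\<close>, hence
  the new polynomial. At the origin the difference quotient is the cutoff function of \<open>X p\<close>, which
  tends to zero since the exponential beats every polynomial.\<close>

lemma exp_cutoff_has_derivative:
  "(exp_cutoff p has_real_derivative exp_cutoff (monom 1 2 * (p - pderiv p)) t) (at t)"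
proof -
  consider "t > 0" | "t = 0" | "t < 0" by linarith
  then show ?thesis
  proof cases
    case 1
    have "((\<lambda>t. poly p (1 / t) * exp (- (1 / t))) has_real_derivative
        exp_cutoff (monom 1 2 * (p - pderiv p)) t) (at t)"
      using 1
      by (auto intro!: derivative_eq_intros poly_DERIV[THEN DERIV_chain2]
          simp: exp_cutoff_def poly_monom field_simps power2_eq_square)
    then show ?thesis
      by (rule has_field_derivative_transform_within_open[where S = "{0<..}"])
        (use 1 in \<open>auto simp: exp_cutoff_def\<close>)
  next
    case 2
    have "((\<lambda>h. exp_cutoff (pCons 0 p) h) \<longlongrightarrow> 0) (at 0)" by (rule exp_cutoff_tendsto_0)
    then have "((\<lambda>h. (exp_cutoff p (0 + h) - exp_cutoff p 0) / h) \<longlongrightarrow> 0) (at 0)"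
      by (rule Lim_transform_eventually)
        (auto simp: eventually_at exp_cutoff_def intro!: exI[of _ 1])
    then show ?thesis using 2 by (simp add: DERIV_def exp_cutoff_def)
  next
    case 3
    have "((\<lambda>t. 0) has_real_derivative exp_cutoff (monom 1 2 * (p - pderiv p)) t) (at t)"
      using 3 by (simp add: exp_cutoff_def)
    then show ?thesis
      by (rule has_field_derivative_transform_within_open[where S = "{..<0}"])
        (use 3 in \<open>auto simp: exp_cutoff_def\<close>)
  qed
qed

lemma C_on_exp_cutoff: "C_on k UNIV (exp_cutoff p)"
proof (induction k arbitrary: p)
  case 0
  then show ?case
    using exp_cutoff_has_derivative DERIV_continuous_on[of UNIV] by fastforce
next
  case (Suc k)
  show ?case
  proof (rule C_on_SucI[OF open_UNIV exp_cutoff_has_derivative[THEN has_field_derivative_imp_has_derivative]])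
    show "C_on k UNIV (\<lambda>t. exp_cutoff (monom 1 2 * (p - pderiv p)) t * v)" for v
      by (rule C_on_bounded_linear[OF open_UNIV bounded_linear_mult_left Suc.IH])
  qed
qed

lemma C_on_id: "open S \<Longrightarrow> C_on k S (\<lambda>x. x)"
proof (cases k)
  case (Suc l)
  assume "open S"
  then show ?thesis unfolding Suc by (intro C_on_SucI[OF _ has_derivative_ident] C_on_const)
qed simp

lemma C_on_inner_self:
  assumes "open S"
  shows "C_on k S (\<lambda>z. (z - a) \<bullet> (z - a))"
proof (cases k)
  case 0
  then show ?thesis by (auto intro!: continuous_intros)
next
  case (Suc l)
  have "((\<lambda>z. (z - a) \<bullet> (z - a)) has_derivative (\<lambda>v. (z - a) \<bullet> v + v \<bullet> (z - a))) (at z)" for z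
    by (auto intro!: derivative_eq_intros)
  moreover have "C_on l S (\<lambda>z. (z - a) \<bullet> v + v \<bullet> (z - a))" for v
  proof -
    have "C_on l S (\<lambda>z. 2 * (v \<bullet> z) + (- 2 * (v \<bullet> a)))"
      by (intro C_on_add assms C_on_const C_on_bounded_linear[OF assms, of "\<lambda>z. 2 * (v \<bullet> z)"] C_on_id)
        (intro bounded_linear_mult_right[THEN bounded_linear_compose] bounded_linear_inner_right)
    then show ?thesis by (simp add: inner_diff_left inner_diff_right inner_commute algebra_simps)
  qed
  ultimately show ?thesis unfolding Suc by (intro C_on_SucI[OF assms])
qed

text \<open>The square of the norm is used because the norm itself is not smooth at the origin.\<close>

lemma smooth_bump_at_point:
  fixes a :: "'e::real_inner"
  assumes "\<epsilon> > 0"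
  obtains \<psi> :: "'e \<Rightarrow> real" where "\<And>k. C_on k UNIV \<psi>" "\<psi> a = 1" "\<And>z. z \<notin> ball a \<epsilon> \<Longrightarrow> \<psi> z = 0"
proof -
  define \<psi> where "\<psi> z = (1 / exp_cutoff 1 (\<epsilon>\<^sup>2)) * exp_cutoff 1 (\<epsilon>\<^sup>2 - (z - a) \<bullet> (z - a))" for z
  have "C_on k UNIV \<psi>" for k
  proof -
    have "C_on k UNIV (\<lambda>z. \<epsilon>\<^sup>2 + (- 1) *\<^sub>R ((z - a) \<bullet> (z - a)))"
      by (intro C_on_add C_on_scaleR C_on_const C_on_inner_self open_UNIV)
    then have "C_on k UNIV (exp_cutoff 1 \<circ> (\<lambda>z. \<epsilon>\<^sup>2 + (- 1) *\<^sub>R ((z - a) \<bullet> (z - a))))"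
      by (intro C_on_compose[of "{1::real}" _ _ UNIV] C_on_exp_cutoff) (auto simp: span_singleton)
    then have "C_on k UNIV (\<lambda>z. (1 / exp_cutoff 1 (\<epsilon>\<^sup>2)) *\<^sub>R (exp_cutoff 1 \<circ> (\<lambda>z. \<epsilon>\<^sup>2 + (- 1) *\<^sub>R ((z - a) \<bullet> (z - a)))) z)"
      by (intro C_on_scaleR C_on_const open_UNIV)
    then show ?thesis by (simp add: \<psi>_def[abs_def])
  qed
  moreover have "\<psi> a = 1" using assms by (simp add: \<psi>_def exp_cutoff_def)
  moreover have "\<psi> z = 0" if "z \<notin> ball a \<epsilon>" for z
  proof -
    have "\<epsilon>\<^sup>2 \<le> (norm (z - a))\<^sup>2" using that assms by (simp add: dist_norm norm_minus_commute)
    then show ?thesis by (simp add: \<psi>_def exp_cutoff_def power2_norm_eq_inner)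
  qed
  ultimately show thesis using that by blast
qed

section \<open>Interpolation by smooth functions on a manifold\<close>

lemma
  assumes "smooth_manifold M \<A>" "c \<in> \<A>"
  shows chart_openin: "openin M (fst c)"
    and open_chart_image: "open (snd c ` fst c)"
    and chart_homeomorphic:
      "homeomorphic_map (subtopology M (fst c)) (top_of_set (snd c ` fst c)) (snd c)"
    and inj_on_chart: "inj_on (snd c) (fst c)"
proof -
  show o: "openin M (fst c)" and "open (snd c ` fst c)" and
    h: "homeomorphic_map (subtopology M (fst c)) (top_of_set (snd c ` fst c)) (snd c)"
    using assms unfolding smooth_manifold_def by blast+
  have "topspace (subtopology M (fst c)) = fst c"
    using openin_subset[OF o] by auto
  with h show "inj_on (snd c) (fst c)"
    using homeomorphic_eq_everything_map by metis
qed

lemma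
  assumes "smooth_manifold M \<A>" "c \<in> \<A>"
  shows chart_inv_left: "p \<in> fst c \<Longrightarrow> chart_inv c (snd c p) = p"
    and chart_inv_right: "z \<in> snd c ` fst c \<Longrightarrow> snd c (chart_inv c z) = z"
  unfolding chart_inv_def
  by (simp_all add: inv_into_f_f[OF inj_on_chart[OF assms]] f_inv_into_f)

lemma open_chart_image_of_openin:
  assumes "smooth_manifold M \<A>" "c \<in> \<A>" "openin M W" "W \<subseteq> fst c"
  shows "open (snd c ` W)"
proof -
  have "openin (subtopology M (fst c)) W"
    using assms chart_openin[OF assms(1,2)] openin_open_subtopology by blast
  then have "openin (top_of_set (snd c ` fst c)) (snd c ` W)"
    using homeomorphic_map_openness_eq[OF chart_homeomorphic[OF assms(1,2)]] by blast
  then show ?thesis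
    using openin_open_trans open_chart_image[OF assms(1,2)] by blast
qed

lemma compactin_of_chart_image:
  assumes "smooth_manifold M \<A>" "c \<in> \<A>" "K \<subseteq> fst c" "compact (snd c ` K)"
  shows "compactin M K"
proof -
  have top: "topspace (subtopology M (fst c)) = fst c"
    using openin_subset[OF chart_openin[OF assms(1,2)]] by auto
  have "compactin (top_of_set (snd c ` fst c)) (snd c ` K)"
    using assms(3,4) by (auto simp: compactin_subtopology)
  then have "compactin (subtopology M (fst c)) K"
    using homeomorphic_map_compactness[OF chart_homeomorphic[OF assms(1,2)]] assms(3) top by auto
  then show ?thesis by (simp add: compactin_subtopology)
qed

lemma smooth_manifold_finite_span:
  fixes \<A> :: "('a, 'e::real_inner) chart set"
  assumes "smooth_manifold M \<A>"
  obtains B :: "'e set" where "finite B" "span B = UNIV"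
  using assms unfolding smooth_manifold_def by blast

lemma transition_smooth:
  assumes "smooth_manifold M \<A>" "c \<in> \<A>" "d \<in> \<A>"
  shows "C_on k (snd c ` (fst c \<inter> fst d)) (transition c d)"
  using assms unfolding smooth_manifold_def smooth_on_def by blast

lemma open_chart_overlap:
  assumes "smooth_manifold M \<A>" "c \<in> \<A>" "d \<in> \<A>"
  shows "open (snd c ` (fst c \<inter> fst d))"
  using assms chart_openin by (blast intro!: open_chart_image_of_openin)

text \<open>A bump function in one chart is transported to the manifold and extended by zero. The extension is
  smooth because its support \<open>K\<close> is closed in the whole manifold and not only in the chart domain:
  \<open>K\<close> corresponds to a closed ball of the model space, so it is compact, and the manifold is
  Hausdorff. In any chart the function is therefore a composition with a transition map on one open
  set and zero on another, and the two cover the chart.\<close>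

lemma smooth_bump_on_manifold:
  fixes M :: "'a topology" and \<A> :: "('a, 'e::real_inner) chart set"
  assumes mfd: "smooth_manifold M \<A>" and W: "openin M W" "p \<in> W"
  obtains f :: "'a \<Rightarrow> real" where "smooth_map \<A> f" "f p = 1" "\<And>q. q \<notin> W \<Longrightarrow> f q = 0"
proof -
  have "p \<in> topspace M" using W openin_subset by blast
  then obtain c where c: "c \<in> \<A>" "p \<in> fst c" using mfd unfolding smooth_manifold_def by blast
  note inv = chart_inv_left[OF mfd] chart_inv_right[OF mfd]
  obtain B :: "'e set" where B: "finite B" "span B = UNIV"
    using smooth_manifold_finite_span[OF mfd] by blast
  have "open (snd c ` (W \<inter> fst c))"
    using open_chart_image_of_openin[OF mfd c(1)] W(1) chart_openin[OF mfd c(1)] by blast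
  then obtain \<epsilon> where \<epsilon>: "\<epsilon> > 0" "cball (snd c p) \<epsilon> \<subseteq> snd c ` (W \<inter> fst c)"
    using W(2) c(2) open_contains_cball by (metis IntI image_eqI)
  obtain \<psi> :: "'e \<Rightarrow> real" where \<psi>: "\<And>k. C_on k UNIV \<psi>" "\<psi> (snd c p) = 1"
    "\<And>z. z \<notin> ball (snd c p) \<epsilon> \<Longrightarrow> \<psi> z = 0"
    using smooth_bump_at_point[OF \<epsilon>(1)] by blast
  define K where "K = chart_inv c ` cball (snd c p) \<epsilon>"
  have K: "K \<subseteq> W \<inter> fst c" "snd c ` K = cball (snd c p) \<epsilon>"
  proof -
    show "K \<subseteq> W \<inter> fst c" using \<epsilon>(2) inv(1)[OF c(1)] unfolding K_def by fastforce
    have "snd c (chart_inv c z) = z" if "z \<in> cball (snd c p) \<epsilon>" for z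
      using inv(2)[OF c(1)] \<epsilon>(2) that by blast
    then show "snd c ` K = cball (snd c p) \<epsilon>" unfolding K_def image_image by simp
  qed
  have "closedin M K"
  proof (rule compactin_imp_closedin)
    show "Hausdorff_space M" using mfd by (simp add: smooth_manifold_def)
    show "compactin M K"
      using compactin_of_chart_image[OF mfd c(1)] K compact_cball_of_finite_span[OF B] by auto
  qed
  define f where "f q = (if q \<in> fst c then \<psi> (snd c q) else 0)" for q
  have f0: "f q = 0" if "q \<notin> K" for q
  proof (cases "q \<in> fst c")
    case True
    have "snd c q \<notin> cball (snd c p) \<epsilon>"
      using that inv(1)[OF c(1) True] unfolding K_def by (metis image_eqI)
    then show ?thesis using \<psi>(3) True by (simp add: f_def)
  qed (simp add: f_def)
  have "C_on k (snd d ` fst d) (f \<circ> chart_inv d)" if d: "d \<in> \<A>" for d k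
  proof -
    let ?U = "snd d ` (fst d \<inter> fst c)" and ?V = "snd d ` (fst d - K)"
    have U: "open ?U" by (rule open_chart_overlap[OF mfd d c(1)])
    have V: "open ?V"
      using open_chart_image_of_openin[OF mfd d] openin_diff[OF chart_openin[OF mfd d] \<open>closedin M K\<close>] by blast
    have "C_on k ?U (\<psi> \<circ> transition d c)"
      by (rule C_on_compose[OF B U subset_UNIV \<psi>(1) transition_smooth[OF mfd d c(1)]])
    then have "C_on k ?U (f \<circ> chart_inv d)"
      by (rule C_on_cong[OF U, rotated]) (auto simp: f_def transition_def inv(1)[OF d])
    moreover have "C_on k ?V (f \<circ> chart_inv d)"
      by (rule C_on_cong[OF V _ C_on_const[OF V]]) (auto simp: inv(1)[OF d] f0)
    ultimately have "C_on k (\<Union>{?U, ?V}) (f \<circ> chart_inv d)"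
      using U V by (intro C_on_Union) auto
    moreover have "\<Union>{?U, ?V} = snd d ` fst d" using K(1) by auto
    ultimately show ?thesis by simp
  qed
  then have "smooth_map \<A> f" by (simp add: smooth_map_def smooth_on_def)
  moreover have "f p = 1" using c(2) \<psi>(2) by (simp add: f_def)
  moreover have "f q = 0" if "q \<notin> W" for q using f0 K(1) that by blast
  ultimately show thesis using that by blast
qed

text \<open>A Lagrange-type sum of bumps: since finite subsets of a Hausdorff space are closed, each point of
  the family has a bump that is 1 there and vanishes at the others.\<close>

lemma smooth_interpolation:
  fixes M :: "'a topology" and \<A> :: "('a, 'e::real_inner) chart set" and w :: "'i \<Rightarrow> real"
  assumes mfd: "smooth_manifold M \<A>" and I: "finite I" "inj_on x I" "x ` I \<subseteq> topspace M"
  obtains f :: "'a \<Rightarrow> real" where "smooth_map \<A> f" "\<And>i. i \<in> I \<Longrightarrow> f (x i) = w i"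
proof -
  have "\<exists>g :: 'a \<Rightarrow> real. smooth_map \<A> g \<and> g (x i) = 1 \<and> (\<forall>j\<in>I - {i}. g (x j) = 0)" if "i \<in> I" for i
  proof -
    let ?W = "topspace M - x ` (I - {i})"
    have "openin M ?W"
      using mfd I by (intro openin_diff openin_topspace closedin_Hausdorff_finite) (auto simp: smooth_manifold_def)
    moreover have "x i \<in> ?W" using I that by (auto dest: inj_onD)
    ultimately obtain g :: "'a \<Rightarrow> real"
      where "smooth_map \<A> g" "g (x i) = 1" "\<And>q. q \<notin> ?W \<Longrightarrow> g q = 0"
      using smooth_bump_on_manifold[OF mfd] by metis
    then show ?thesis by blast
  qed
  then obtain g :: "'i \<Rightarrow> 'a \<Rightarrow> real" where g: "\<And>i. i \<in> I \<Longrightarrow> smooth_map \<A> (g i)" "\<And>i. i \<in> I \<Longrightarrow> g i (x i) = 1"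
    "\<And>i j. i \<in> I \<Longrightarrow> j \<in> I \<Longrightarrow> j \<noteq> i \<Longrightarrow> g i (x j) = 0"
    by (metis DiffI singletonD)
  define f where "f q = (\<Sum>i\<in>I. w i *\<^sub>R g i q)" for q
  have "C_on k (snd c ` fst c) (f \<circ> chart_inv c)" if c: "c \<in> \<A>" for c k
  proof -
    have "C_on k (snd c ` fst c) (\<lambda>z. \<Sum>i\<in>I. w i *\<^sub>R (g i \<circ> chart_inv c) z)"
    proof (rule C_on_sum[OF open_chart_image[OF mfd c] I(1)],
        rule C_on_scaleR[OF open_chart_image[OF mfd c] C_on_const[OF open_chart_image[OF mfd c]]])
      fix i assume "i \<in> I"
      from g(1)[OF this] c have "C_on k (snd c ` fst c) (g i \<circ> chart_inv c)"
        unfolding smooth_map_def smooth_on_def by blast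
      then show "C_on k (snd c ` fst c) (\<lambda>z. (g i \<circ> chart_inv c) z)" by (simp add: o_def)
    qed
    then show ?thesis by (simp add: f_def o_def)
  qed
  then have "smooth_map \<A> f" by (simp add: smooth_map_def smooth_on_def)
  moreover have "f (x i) = w i" if "i \<in> I" for i
  proof -
    have "f (x i) = (\<Sum>j\<in>I. if j = i then w i else 0)"
      unfolding f_def by (rule sum.cong) (use g that in auto)
    then show ?thesis using I(1) that by simp
  qed
  ultimately show thesis using that by blast
qed

section \<open>The differential of a smooth function as a closed one-form\<close>

lemma smooth_map_compose:
  assumes mfd: "smooth_manifold M \<A>" and "smooth_map \<A> (f :: 'a \<Rightarrow> real)" "\<And>k. C_on k UNIV g"
  shows "smooth_map \<A> (g \<circ> f)"
proof -
  have "C_on k (snd c ` fst c) (g \<circ> (f \<circ> chart_inv c))" if c: "c \<in> \<A>" for c k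
    using assms(2,3) c open_chart_image[OF mfd c] unfolding smooth_map_def smooth_on_def
    by (intro C_on_compose[of "{1::real}" _ _ UNIV]) (auto simp: span_singleton)
  then show ?thesis by (simp add: smooth_map_def smooth_on_def o_assoc)
qed

lemma smooth_map_differentiable:
  assumes mfd: "smooth_manifold M \<A>" and "smooth_map \<A> f" "c \<in> \<A>" "p \<in> fst c"
  shows "(f \<circ> chart_inv c) differentiable (at (snd c p))"
proof -
  have "C_on (Suc 0) (snd c ` fst c) (f \<circ> chart_inv c)"
    using assms unfolding smooth_map_def smooth_on_def by blast
  then show ?thesis using assms(4) by auto
qed

text \<open>The compatibility of the local representations is the chain rule for \<open>f \<circ> c\<^sup>-\<^sup>1 = (f \<circ> d\<^sup>-\<^sup>1) \<circ> (d \<circ> c\<^sup>-\<^sup>1)\<close>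
  on the chart overlap.\<close>

lemma one_form_differential:
  assumes mfd: "smooth_manifold M \<A>" and f: "smooth_map \<A> f"
  shows "one_form \<A> (differential f)"
  unfolding one_form_def
proof (intro conjI ballI allI)
  fix c p assume c: "c \<in> \<A>" "p \<in> fst c"
  show "linear (differential f c p)"
    unfolding differential_def[abs_def]
    using linear_frechet_derivative[OF smooth_map_differentiable[OF mfd f c]] by simp
next
  fix c v assume c: "c \<in> \<A>"
  have "C_on k (snd c ` fst c) (\<lambda>z. differential f c (chart_inv c z) v)" for k
  proof (rule C_on_cong[OF open_chart_image[OF mfd c]])
    show "C_on k (snd c ` fst c) (\<lambda>z. frechet_derivative (f \<circ> chart_inv c) (at z) v)"
      by (rule C_on_SucD(2)) (use f c in \<open>auto simp: smooth_map_def smooth_on_def simp del: C_on.simps\<close>)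
  qed (simp add: differential_def chart_inv_right[OF mfd c])
  then show "smooth_on (snd c ` fst c) (\<lambda>z. differential f c (chart_inv c z) v)"
    by (simp add: smooth_on_def)
next
  fix c d p v assume c: "c \<in> \<A>" and d: "d \<in> \<A>" and p: "p \<in> fst c \<inter> fst d"
  let ?U = "snd c ` (fst c \<inter> fst d)" and ?T = "transition c d"
  have U: "open ?U" "snd c p \<in> ?U" using open_chart_overlap[OF mfd c d] p by auto
  have T: "?T (snd c p) = snd d p" using p by (simp add: transition_def chart_inv_left[OF mfd c])
  have "C_on (Suc 0) ?U ?T" by (rule transition_smooth[OF mfd c d])
  then have dT: "?T differentiable (at (snd c p))" using U(2) by auto
  have df: "(f \<circ> chart_inv d) differentiable (at (?T (snd c p)))"
    unfolding T using smooth_map_differentiable[OF mfd f d] p by simp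
  have "frechet_derivative (f \<circ> chart_inv c) (at (snd c p)) = frechet_derivative ((f \<circ> chart_inv d) \<circ> ?T) (at (snd c p))"
  proof (rule frechet_derivative_transform_within_open[OF smooth_map_differentiable[OF mfd f c] U])
    show "(f \<circ> chart_inv c) z = ((f \<circ> chart_inv d) \<circ> ?T) z" if "z \<in> ?U" for z
      using that by (auto simp: transition_def chart_inv_left[OF mfd c] chart_inv_left[OF mfd d])
  qed (use p in auto)
  also have "\<dots> = frechet_derivative (f \<circ> chart_inv d) (at (snd d p)) \<circ> frechet_derivative ?T (at (snd c p))"
    using frechet_derivative_compose[OF dT df] unfolding T .
  finally show "differential f c p v = differential f d p (frechet_derivative ?T (at (snd c p)) v)"
    by (simp add: differential_def)
qed

text \<open>The exterior derivative of an exact form vanishes by symmetry of second derivatives.\<close>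

lemma ext_deriv_differential:
  fixes f :: "'a \<Rightarrow> real"
  assumes mfd: "smooth_manifold M \<A>" and f: "smooth_map \<A> f" and c: "c \<in> \<A>" and p: "p \<in> fst c"
  shows "ext_deriv (differential f) c p u v = 0"
proof -
  let ?F = "f \<circ> chart_inv c" and ?S = "snd c ` fst c"
  have S: "open ?S" "snd c p \<in> ?S" using open_chart_image[OF mfd c] p by auto
  have C2: "C_on 2 ?S ?F" using f c unfolding smooth_map_def smooth_on_def by blast
  have "frechet_derivative (\<lambda>z. differential f c (chart_inv c z) w) (at (snd c p)) =
        frechet_derivative (\<lambda>z. frechet_derivative ?F (at z) w) (at (snd c p))" for w
  proof (rule frechet_derivative_transform_within_open[OF _ S, symmetric])
    show "(\<lambda>z. frechet_derivative ?F (at z) w) differentiable (at (snd c p))"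
      using C2 S(2) by (auto simp: numeral_2_eq_2)
    show "frechet_derivative ?F (at z) w = differential f c (chart_inv c z) w" if "z \<in> ?S" for z
      using chart_inv_right[OF mfd c that] by (simp add: differential_def)
  qed
  then show ?thesis
    using frechet_derivative_commute[OF S(1) C2 S(2)] by (simp add: ext_deriv_def)
qed

text \<open>Applied to \<open>L t = t B\<close> for a fixed matrix \<open>B\<close>, this lemma and the next one produce matrix-valued
  forms from real ones.\<close>

lemma one_form_bounded_linear:
  assumes mfd: "smooth_manifold M \<A>" and \<omega>: "one_form \<A> \<omega>" and L: "bounded_linear L"
  shows "one_form \<A> (\<lambda>c p v. L (\<omega> c p v))"
  unfolding one_form_def
proof (intro conjI ballI allI)
  fix c p assume "c \<in> \<A>" "p \<in> fst c"
  then have "linear (\<omega> c p)" using \<omega> by (auto simp: one_form_def)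
  then show "linear (\<lambda>v. L (\<omega> c p v))"
    using linear_compose[OF _ bounded_linear.linear[OF L]] by (simp add: o_def)
next
  fix c v assume c: "c \<in> \<A>"
  then show "smooth_on (snd c ` fst c) (\<lambda>z. L (\<omega> c (chart_inv c z) v))"
    using \<omega> C_on_bounded_linear[OF open_chart_image[OF mfd c] L]
    unfolding one_form_def smooth_on_def by blast
next
  fix c d p v assume "c \<in> \<A>" "d \<in> \<A>" "p \<in> fst c \<inter> fst d"
  then show "L (\<omega> c p v) = L (\<omega> d p (frechet_derivative (transition c d) (at (snd c p)) v))"
    using \<omega> unfolding one_form_def by metis
qed

lemma ext_deriv_bounded_linear:
  assumes \<omega>: "one_form \<A> \<omega>" and L: "bounded_linear L" and c: "c \<in> \<A>" and p: "p \<in> fst c"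
  shows "ext_deriv (\<lambda>c p v. L (\<omega> c p v)) c p u v = L (ext_deriv \<omega> c p u v)"
proof -
  have "frechet_derivative (\<lambda>z. L (\<omega> c (chart_inv c z) w)) (at (snd c p)) =
        (\<lambda>h. L (frechet_derivative (\<lambda>z. \<omega> c (chart_inv c z) w) (at (snd c p)) h))" for w
  proof (rule frechet_derivative_at[symmetric], rule bounded_linear.has_derivative[OF L])
    have "C_on (Suc 0) (snd c ` fst c) (\<lambda>z. \<omega> c (chart_inv c z) w)"
      using \<omega> c unfolding one_form_def smooth_on_def by blast
    then show "((\<lambda>z. \<omega> c (chart_inv c z) w) has_derivative
        frechet_derivative (\<lambda>z. \<omega> c (chart_inv c z) w) (at (snd c p))) (at (snd c p))"
      using p C_on_SucD(1) by blast
  qed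
  then show ?thesis by (simp add: ext_deriv_def linear_diff[OF bounded_linear.linear[OF L]])
qed

section \<open>Rotation by a smooth angle function\<close>

definition circle_curve :: "(nat \<Rightarrow> 'm::finite) \<Rightarrow> real \<Rightarrow> real \<Rightarrow> real^'m" where
  "circle_curve e r t = (r * cos t) *\<^sub>R axis (e 1) 1 + (r * sin t) *\<^sub>R axis (e 2) 1"

lemma C_on_cos_sin: "C_on k UNIV (cos :: real \<Rightarrow> real) \<and> C_on k UNIV (sin :: real \<Rightarrow> real)"
proof (induction k)
  case 0
  then show ?case by (auto intro: continuous_intros)
next
  case (Suc k)
  have "C_on k UNIV (\<lambda>t::real. (- v) * sin t)" "C_on k UNIV (\<lambda>t::real. v * cos t)" for v :: real
    using Suc by (blast intro: C_on_bounded_linear[OF open_UNIV bounded_linear_mult_right, of _ sin]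
        C_on_bounded_linear[OF open_UNIV bounded_linear_mult_right, of _ cos])+
  then have "C_on k UNIV (\<lambda>t::real. - sin t * v)" "C_on k UNIV (\<lambda>t::real. cos t * v)" for v :: real
    by (simp_all add: mult.commute)
  then show ?case
    by (intro conjI C_on_SucI[OF open_UNIV DERIV_cos[THEN has_field_derivative_imp_has_derivative]]
          C_on_SucI[OF open_UNIV DERIV_sin[THEN has_field_derivative_imp_has_derivative]])
qed

lemma C_on_circle_curve: "C_on k UNIV (circle_curve e r)"
proof -
  have "C_on k UNIV (\<lambda>t. (r *\<^sub>R cos t) *\<^sub>R axis (e 1) (1::real) + (r *\<^sub>R sin t) *\<^sub>R axis (e 2) 1)"
    by (intro C_on_add C_on_scaleR C_on_const open_UNIV C_on_cos_sin[THEN conjunct1] C_on_cos_sin[THEN conjunct2])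
  then show ?thesis by (simp add: circle_curve_def[abs_def])
qed

lemma rotJ_circle_curve:
  assumes "e 1 \<noteq> e 2"
  shows "rotJ e *v circle_curve e r t = (- (r * sin t)) *\<^sub>R axis (e 1) 1 + (r * cos t) *\<^sub>R axis (e 2) 1"
proof -
  have "rotJ e *v axis (e 1) 1 = axis (e 2) 1" "rotJ e *v axis (e 2) 1 = - axis (e 1) 1"
    unfolding matrix_vector_mult_basis column_def
    using assms by (auto simp: vec_eq_iff rotJ_def axis_def)
  then show ?thesis
    by (simp add: circle_curve_def matrix_vector_right_distrib matrix_vector_mult_scaleR)
qed

text \<open>The curve is an orbit of the rotation group generated by \<open>J\<close>, so its velocity is \<open>J\<close> applied to its
  position. This is what makes the section parallel.\<close>

lemma circle_curve_has_derivative: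
  assumes "e 1 \<noteq> e 2"
  shows "(circle_curve e r has_derivative (\<lambda>h. h *\<^sub>R (rotJ e *v circle_curve e r t))) (at t)"
  unfolding circle_curve_def[abs_def] rotJ_circle_curve[OF assms, unfolded circle_curve_def]
  by (auto intro!: derivative_eq_intros simp: scaleR_add_right algebra_simps)

lemma norm_circle_curve:
  assumes "e 1 \<noteq> e 2"
  shows "norm (circle_curve e r t) = \<bar>r\<bar>"
proof -
  have "(norm (circle_curve e r t))\<^sup>2 = (r * cos t) * (r * cos t) + (r * sin t) * (r * sin t)"
    unfolding power2_norm_eq_inner circle_curve_def
    using assms by (simp add: inner_add_left inner_add_right inner_axis_axis)
  also have "\<dots> = r\<^sup>2 * ((cos t)\<^sup>2 + (sin t)\<^sup>2)" by (simp only: power2_eq_square ring_distribs mult_ac)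
  finally have "(norm (circle_curve e r t))\<^sup>2 = \<bar>r\<bar>\<^sup>2" by simp
  then show ?thesis using power2_eq_iff_nonneg[of "norm (circle_curve e r t)" "\<bar>r\<bar>"] by simp
qed

lemma scaleR_matrix_mult_commute:
  fixes B :: "real^'m::finite^'m"
  shows "(a *\<^sub>R B) ** (b *\<^sub>R B) = (a * b) *\<^sub>R (B ** B)"
  by (simp add: vec_eq_iff matrix_matrix_mult_def sum_distrib_left mult_ac)

text \<open>Both curvature terms vanish separately: \<open>d(df \<cdot> B) = d(df) B = 0\<close>, and the wedge term is a multiple of
  commutators of \<open>B\<close> with itself, as the structure group is abelian.\<close>

lemma flat_differential_scaleR:
  fixes f :: "'a \<Rightarrow> real" and \<A> :: "('a, 'e::real_inner) chart set" and J :: "real^'m::finite^'m"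
  assumes mfd: "smooth_manifold M \<A>" and f: "smooth_map \<A> f"
  shows "flat \<A> (\<lambda>c p v. differential f c p v *\<^sub>R (- J))"
  unfolding flat_def curvature_def
proof (intro ballI allI)
  fix c p u v assume c: "c \<in> \<A>" "p \<in> fst c"
  have "ext_deriv (\<lambda>c p v. differential f c p v *\<^sub>R (- J)) c p u v = 0"
    using ext_deriv_bounded_linear[OF one_form_differential[OF mfd f] bounded_linear_scaleR_left c]
      ext_deriv_differential[OF mfd f c] by (simp only: scaleR_zero_left)
  then show "ext_deriv (\<lambda>c p v. differential f c p v *\<^sub>R (- J)) c p u v +
      wedge (\<lambda>c p v. differential f c p v *\<^sub>R (- J)) (\<lambda>c p v. differential f c p v *\<^sub>R (- J)) c p u v = 0"
    by (simp only: wedge_def scaleR_matrix_mult_commute mult.commute diff_self add_0_right)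
qed

theorem theorem8p5:
  fixes M :: "'a topology"
    and \<A> :: "('a, 'e::real_inner) chart set"
    and m N :: nat
    and e :: "nat \<Rightarrow> 'm::finite"
    and r :: real
    and x :: "nat \<Rightarrow> 'a"
    and y :: "nat \<Rightarrow> real"
  assumes "smooth_manifold M \<A>"
    and "m \<ge> 2"
    and "bij_betw e {1..m} UNIV"
    and "r > 0"
    and "classification_dataset M N x y"
  shows "\<exists>(s :: 'a \<Rightarrow> real^'m) (A :: ('a, 'e, real^'m^'m) form1).
    smooth_map \<A> s \<and>
    (\<forall>p\<in>topspace M. \<forall>i. i \<notin> {e 1, e 2} \<longrightarrow> s p $ i = 0) \<and>
    (\<exists>k. \<forall>p\<in>topspace M. norm (s p) = k) \<and>
    O2_connection e \<A> A \<and>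
    flat \<A> A \<and>
    solves_classification M \<A> N x y (readout e) r A s"
proof -
  note mfd = assms(1)
  have e12: "e 1 \<noteq> e 2"
    using assms(2) bij_betw_imp_inj_on[OF assms(3)] by (auto dest: inj_onD)
  have data: "finite {1..N}" "inj_on x {1..N}" "x ` {1..N} \<subseteq> topspace M"
    "\<And>i. i \<in> {1..N} \<Longrightarrow> y i = 1 \<or> y i = -1"
    using assms(5) by (auto simp: classification_dataset_def)
  obtain f :: "'a \<Rightarrow> real" where f: "smooth_map \<A> f"
    "\<And>i. i \<in> {1..N} \<Longrightarrow> f (x i) = (if y i = 1 then 0 else pi)"
    using smooth_interpolation[OF mfd data(1-3), where w = "\<lambda>i. if y i = 1 then 0 else pi"] by blast
  \<comment> \<open>\<open>A = -df J\<close> is the gauge transform of the trivial connection by the rotation through the angle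
    \<open>f\<close>, and \<open>s\<close> is the image of a constant section under that rotation.\<close>
  define s where "s = circle_curve e r \<circ> f"
  define A :: "('a, 'e, real^'m^'m) form1" where "A c p v = differential f c p v *\<^sub>R (- rotJ e)" for c p v
  have ds: "differential s c p v = differential f c p v *\<^sub>R (rotJ e *v s p)" if c: "c \<in> \<A>" "p \<in> fst c" for c p v
  proof -
    let ?F = "f \<circ> chart_inv c"
    have "(?F has_derivative frechet_derivative ?F (at (snd c p))) (at (snd c p))"
      using smooth_map_differentiable[OF mfd f(1) c] by (simp add: frechet_derivative_works)
    from diff_chain_at[OF this circle_curve_has_derivative[OF e12]]
    have "(s \<circ> chart_inv c has_derivative
        (\<lambda>v. differential f c p v *\<^sub>R (rotJ e *v s p))) (at (snd c p))"
      by (simp add: o_def differential_def s_def chart_inv_left[OF mfd c])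
    from frechet_derivative_at[OF this, symmetric] show ?thesis by (simp add: differential_def)
  qed
  have "smooth_map \<A> s" unfolding s_def by (rule smooth_map_compose[OF mfd f(1) C_on_circle_curve])
  moreover have "s p $ i = 0" if "i \<notin> {e 1, e 2}" for p i
    using that by (simp add: s_def circle_curve_def axis_def)
  moreover have norm: "norm (s p) = \<bar>r\<bar>" for p
    by (simp add: s_def norm_circle_curve[OF e12])
  moreover have "O2_connection e \<A> A"
  proof -
    have "one_form \<A> A" unfolding A_def[abs_def]
      by (rule one_form_bounded_linear[OF mfd one_form_differential[OF mfd f(1)] bounded_linear_scaleR_left])
    moreover have "A c p v \<in> so2 e" for c p v
      unfolding so2_eq[OF e12] A_def by (rule range_eqI[of _ _ "- differential f c p v"]) simp
    ultimately show ?thesis by (simp add: O2_connection_def)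
  qed
  moreover have "flat \<A> A" unfolding A_def[abs_def] by (rule flat_differential_scaleR[OF mfd f(1)])
  moreover have "solves_classification M \<A> N x y (readout e) r A s"
    unfolding solves_classification_def
  proof (intro conjI ballI)
    show "s p \<noteq> 0" for p using norm[of p] assms(4) by auto
    have "A c p v *v s p = - (differential f c p v *\<^sub>R (rotJ e *v s p))" for c p v
    proof -
      have "(- rotJ e) *v s p = - (rotJ e *v s p)"
        by (simp add: vec_eq_iff matrix_vector_mult_def sum_negf)
      then show ?thesis unfolding A_def scaleR_matrix_vector_assoc[symmetric] by simp
    qed
    then show "parallel \<A> A s"
      by (simp add: parallel_def cov_deriv_def ds)
    show "readout e (s (x i)) = y i * r" if "i \<in> {1..N}" for i
      using f(2)[OF that] data(4)[OF that] e12 by (auto simp: readout_def s_def circle_curve_def axis_def)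
  qed
  ultimately show ?thesis by blast
qed

end
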